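(* Let $V(n)$ be an $r \times d$ matrix and $c(n)$ an $r \times 1$ column vector, all of whose entries are polynomials in $n$ with integer coefficients. For $n$ sufficiently large, let $P(n) = \{x \in \mathbf{R}^d \mid V(n)x \ge c(n)\}$, and assume that for all sufficiently large $n$ this is a (bounded) rational polytope. Then the function $n \mapsto \#(P(n) \cap \mathbf{Z}^d)$ lies in $\mathbf{QP}_{\gg 0}$.
   Context: For vectors $x,y$, $x \ge y$ means $x_i \ge y_i$ for all $i$. A function $f$ defined on all sufficiently large integers with integer values is eventually a quasi-polynomial if there exist a positive integer $s$ and polynomials $f_0,\dots,f_{s-1} \in \mathbf{Q}[t]$ such that $f(n) = f_i(n)$ for all sufficiently large $n$ with $n \equiv i \pmod s$. $\mathbf{QP}_{\gg 0}$ denotes the set of such functions. *)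

theory Defs
  imports
    "HOL-Analysis.Analysis"
    "HOL-Computational_Algebra.Polynomial"
    "HOL-Number_Theory.Cong"
begin

text \<open>Functions that are only defined for large integers are represented by total functions on
  \<^typ>\<open>int\<close>; membership in \<open>QP_eventually\<close> depends only on the values at large arguments.\<close>

definition QP_eventually :: "(int \<Rightarrow> int) set" where
  "QP_eventually = {f. \<exists>s::nat. s > 0 \<and> (\<exists>g :: nat \<Rightarrow> rat poly. \<forall>i<s.
     eventually (\<lambda>n. [n = int i] (mod int s) \<longrightarrow> rat_of_int (f n) = poly (g i) (rat_of_int n)) at_top)}"

definition eval_mat :: "int poly ^ 'd ^ 'r \<Rightarrow> int \<Rightarrow> real ^ 'd ^ 'r" where
  "eval_mat V n = (\<chi> i j. real_of_int (poly (V $ i $ j) n))"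

definition eval_vec :: "int poly ^ 'r \<Rightarrow> int \<Rightarrow> real ^ 'r" where
  "eval_vec c n = (\<chi> i. real_of_int (poly (c $ i) n))"

text \<open>The order on \<^typ>\<open>real ^ 'r\<close> is the componentwise one.\<close>

definition param_polyhedron :: "int poly ^ 'd ^ 'r \<Rightarrow> int poly ^ 'r \<Rightarrow> int \<Rightarrow> (real ^ 'd) set" where
  "param_polyhedron V c n = {x. eval_mat V n *v x \<ge> eval_vec c n}"

text \<open>The library's \<^const>\<open>polytope\<close> (convex hull of a finite set) is bounded and may be empty;
  its vertices are its extreme points.\<close>

definition rational_polytope :: "(real ^ 'd) set \<Rightarrow> bool" where
  "rational_polytope S \<longleftrightarrow> polytope S \<and> (\<forall>v. v extreme_point_of S \<longrightarrow> (\<forall>i. v $ i \<in> \<rat>))"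

definition integer_points :: "(real ^ 'd) set" where
  "integer_points = {x. \<forall>i. x $ i \<in> \<int>}"

end

theory Submission imports Defs begin

text \<open>
  Fourier-Motzkin elimination over \<open>\<int>[n]\<close>, ordered by the sign of the leading coefficient, shows that the
  coordinates of points of the polytope are bounded by some \<open>n ^ k\<close>. Writing the (shifted) coordinates of
  lattice points in base \<open>n\<close>, every defining inequality becomes \<open>l\<^sub>0 + n l\<^sub>1 + n\<^sup>2 l\<^sub>2 + \<dots> \<ge> 0\<close> with forms \<open>l\<^sub>m\<close>
  that are affine in the digits with constant integer coefficients. Since \<open>l\<^sub>m = O(n)\<close>, carries from one
  power of \<open>n\<close> to the next take only boundedly many values, so the inequality is a Boolean combination of
  affine inequalities with constant coefficients in the digits and \<open>n\<close>. It remains to sum an indicator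
  function over the box of digits. The algebra generated by affine terms with floor division by
  constants, and by indicators of \<open>t \<ge> 0\<close> for such terms, is closed under summation of a variable over
  \<open>{0..<n}\<close>: on a residue class of that variable all floors disappear. The functions of \<open>n\<close> alone in
  this algebra are eventually quasi-polynomial.
\<close>

section \<open>Piecewise quasi-polynomials\<close>

text \<open>Variable \<open>0\<close> plays the role of the parameter \<open>n\<close>; only the variables below \<open>N\<close> occur.\<close>

inductive_set lin_terms :: "nat \<Rightarrow> ((nat \<Rightarrow> int) \<Rightarrow> int) set" for N where
  lin_const: "(\<lambda>x. c) \<in> lin_terms N"
| lin_var: "i < N \<Longrightarrow> (\<lambda>x. x i) \<in> lin_terms N"
| lin_add: "s \<in> lin_terms N \<Longrightarrow> t \<in> lin_terms N \<Longrightarrow> (\<lambda>x. s x + t x) \<in> lin_terms N"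
| lin_scale: "t \<in> lin_terms N \<Longrightarrow> (\<lambda>x. a * t x) \<in> lin_terms N"
| lin_div: "t \<in> lin_terms N \<Longrightarrow> m > 0 \<Longrightarrow> (\<lambda>x. t x div m) \<in> lin_terms N"

text \<open>Values are rational rather than integer because summing powers over a variable produces
  polynomials with rational coefficients.\<close>

inductive_set pw_qpolys :: "nat \<Rightarrow> ((nat \<Rightarrow> int) \<Rightarrow> rat) set" for N where
  pw_const: "(\<lambda>x. c) \<in> pw_qpolys N"
| pw_term: "t \<in> lin_terms N \<Longrightarrow> (\<lambda>x. of_int (t x)) \<in> pw_qpolys N"
| pw_ge_0: "t \<in> lin_terms N \<Longrightarrow> (\<lambda>x. of_bool (t x \<ge> 0)) \<in> pw_qpolys N"
| pw_add: "f \<in> pw_qpolys N \<Longrightarrow> g \<in> pw_qpolys N \<Longrightarrow> (\<lambda>x. f x + g x) \<in> pw_qpolys N"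
| pw_mult: "f \<in> pw_qpolys N \<Longrightarrow> g \<in> pw_qpolys N \<Longrightarrow> (\<lambda>x. f x * g x) \<in> pw_qpolys N"

section \<open>Closure properties and dependence on the first \<open>N\<close> variables\<close>

lemma lin_diff:
  assumes "s \<in> lin_terms N" "t \<in> lin_terms N"
  shows "(\<lambda>x. s x - t x) \<in> lin_terms N"
  using lin_add[OF assms(1) lin_scale[OF assms(2), of "-1"]] by simp

lemma pw_diff:
  assumes "f \<in> pw_qpolys N" "g \<in> pw_qpolys N"
  shows "(\<lambda>x. f x - g x) \<in> pw_qpolys N"
  using pw_add[OF assms(1) pw_mult[OF pw_const[of "-1"] assms(2)]] by simp

lemma pw_sum:
  assumes "\<And>i. i \<in> A \<Longrightarrow> f i \<in> pw_qpolys N"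
  shows "(\<lambda>x. \<Sum>i\<in>A. f i x) \<in> pw_qpolys N"
  using assms by (induction A rule: infinite_finite_induct) (auto intro: pw_const pw_add)

lemma pw_prod:
  assumes "\<And>i. i \<in> A \<Longrightarrow> f i \<in> pw_qpolys N"
  shows "(\<lambda>x. \<Prod>i\<in>A. f i x) \<in> pw_qpolys N"
  using assms by (induction A rule: infinite_finite_induct) (auto intro: pw_const pw_mult)

lemma pw_le:
  assumes "s \<in> lin_terms N" "t \<in> lin_terms N"
  shows "(\<lambda>x. of_bool (s x \<le> t x)) \<in> pw_qpolys N"
  using pw_ge_0[OF lin_diff[OF assms(2,1)]] by simp

lemma pw_less:
  assumes "s \<in> lin_terms N" "t \<in> lin_terms N"
  shows "(\<lambda>x. of_bool (s x < t x)) \<in> pw_qpolys N"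
  using pw_le[OF lin_add[OF assms(1) lin_const[of 1]] assms(2)] by (simp add: zless_iff_Suc_zadd add1_zle_eq)

lemma pw_poly:
  assumes "t \<in> lin_terms N"
  shows "(\<lambda>x. poly p (of_int (t x))) \<in> pw_qpolys N"
  by (induction p) (auto intro!: pw_const pw_add pw_mult pw_term assms)

lemma lin_terms_cong:
  assumes "t \<in> lin_terms N" "\<And>i. i < N \<Longrightarrow> x i = y i"
  shows "t x = t y"
  using assms by (induction) auto

lemma pw_qpolys_cong:
  assumes "f \<in> pw_qpolys N" "\<And>i. i < N \<Longrightarrow> x i = y i"
  shows "f x = f y"
  using assms(1)
proof induction
  case (pw_term t)
  then show ?case using lin_terms_cong[of t N x y] assms(2) by simp
next
  case (pw_ge_0 t)
  then show ?case using lin_terms_cong[of t N x y] assms(2) by simp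
qed simp_all

section \<open>Splitting off the last variable on a residue class\<close>

text \<open>Each division by \<open>m\<close> puts a factor \<open>m\<close> into the modulus; then
  \<open>(a * m * z + u) div m = a * z + u div m\<close>, so the floor acts only on the other
  variables. The free factor \<open>k\<close> lets two moduli be raised to the common multiple
  \<open>M * M'\<close> when terms are added.\<close>

lemma lin_terms_split:
  assumes "t \<in> lin_terms (Suc N)"
  shows "\<exists>M>0. \<forall>k>0. \<forall>r. \<exists>a. \<exists>u\<in>lin_terms N. \<forall>x z. t (x(N := M * k * z + r)) = a * z + u x"
  using assms
proof induction
  case (lin_const c)
  show ?case
    by (rule exI[of _ 1]) (auto intro!: exI[of _ 0] bexI[OF _ lin_terms.lin_const])
next
  case (lin_var i)
  show ?case
  proof (cases "i = N")
    case True
    then show ?thesis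
      by (intro exI[of _ 1]) (auto intro!: exI bexI[OF _ lin_terms.lin_const])
  next
    case False
    with lin_var have "i < N" by simp
    then show ?thesis
      by (intro exI[of _ 1]) (auto intro!: exI[of _ 0] bexI[OF _ lin_terms.lin_var])
  qed
next
  case (lin_add s t)
  from lin_add.IH(1) obtain M where M: "M > 0"
    "\<forall>k>0. \<forall>r. \<exists>a. \<exists>u\<in>lin_terms N. \<forall>x z. s (x(N := M * k * z + r)) = a * z + u x"
    by (elim exE conjE)
  from lin_add.IH(2) obtain M' where M': "M' > 0"
    "\<forall>k>0. \<forall>r. \<exists>a. \<exists>u\<in>lin_terms N. \<forall>x z. t (x(N := M' * k * z + r)) = a * z + u x"
    by (elim exE conjE)
  show ?case
  proof (rule exI[of _ "M * M'"], intro conjI allI impI)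
    fix k r :: int assume "k > 0"
    have pos: "M' * k > 0" "M * k > 0" using M M' \<open>k > 0\<close> by simp_all
    from M(2)[rule_format, OF pos(1), of r]
    obtain a u where u: "u \<in> lin_terms N" "\<forall>x z. s (x(N := M * (M' * k) * z + r)) = a * z + u x"
      by (elim exE bexE)
    from M'(2)[rule_format, OF pos(2), of r]
    obtain b v where v: "v \<in> lin_terms N" "\<forall>x z. t (x(N := M' * (M * k) * z + r)) = b * z + v x"
      by (elim exE bexE)
    have "M' * (M * k) = M * M' * k" "M * (M' * k) = M * M' * k" by simp_all
    then show "\<exists>a. \<exists>u\<in>lin_terms N. \<forall>x z. s (x(N := M * M' * k * z + r)) + t (x(N := M * M' * k * z + r)) = a * z + u x"
      using u v by (intro exI[of _ "a + b"] bexI[OF _ lin_terms.lin_add[OF u(1) v(1)]])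
        (auto simp: algebra_simps)
  qed (use M M' in auto)
next
  case (lin_scale t c)
  from lin_scale.IH obtain M where M: "M > 0"
    "\<forall>k>0. \<forall>r. \<exists>a. \<exists>u\<in>lin_terms N. \<forall>x z. t (x(N := M * k * z + r)) = a * z + u x"
    by (elim exE conjE)
  show ?case
  proof (rule exI[of _ M], intro conjI allI impI)
    fix k r :: int assume "k > 0"
    from M(2)[rule_format, OF this, of r]
    obtain a u where u: "u \<in> lin_terms N" "\<forall>x z. t (x(N := M * k * z + r)) = a * z + u x"
      by (elim exE bexE)
    then show "\<exists>a. \<exists>u\<in>lin_terms N. \<forall>x z. c * t (x(N := M * k * z + r)) = a * z + u x"
      by (intro exI[of _ "c * a"] bexI[OF _ lin_terms.lin_scale[OF u(1), of c]]) (auto simp: algebra_simps)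
  qed (use M in auto)
next
  case (lin_div t m)
  from lin_div.IH obtain M where M: "M > 0"
    "\<forall>k>0. \<forall>r. \<exists>a. \<exists>u\<in>lin_terms N. \<forall>x z. t (x(N := M * k * z + r)) = a * z + u x"
    by (elim exE conjE)
  show ?case
  proof (rule exI[of _ "M * m"], intro conjI allI impI)
    fix k r :: int assume k: "k > 0"
    from M(2)[rule_format, OF this, of r]
    obtain a u where u: "u \<in> lin_terms N" "\<And>x z. t (x(N := M * k * z + r)) = a * z + u x"
      by (elim exE bexE) metis
    have "t (x(N := M * m * k * z + r)) div m = a * z + u x div m" for x z
    proof -
      have "t (x(N := M * m * k * z + r)) = u x + m * (a * z)"
        using u(2)[of x "m * z"] by (simp add: algebra_simps)
      then show ?thesis using \<open>m > 0\<close> by simp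
    qed
    then show "\<exists>a. \<exists>u\<in>lin_terms N. \<forall>x z. t (x(N := M * m * k * z + r)) div m = a * z + u x"
      by (intro exI[of _ a] bexI[OF _ lin_terms.lin_div[OF u(1) \<open>m > 0\<close>]]) auto
  qed (use M \<open>m > 0\<close> in auto)
qed

text \<open>The second argument \<open>z\<close> is the quotient of the last variable by a common multiple of the
  denominators in which it occurs.\<close>

inductive_set cut_polys :: "nat \<Rightarrow> ((nat \<Rightarrow> int) \<Rightarrow> int \<Rightarrow> rat) set" for N where
  cut_mono: "h \<in> pw_qpolys N \<Longrightarrow> u \<in> lin_terms N \<Longrightarrow>
    (\<lambda>x z. h x * of_int z ^ k * of_bool (u x \<le> z)) \<in> cut_polys N"
| cut_add: "f \<in> cut_polys N \<Longrightarrow> g \<in> cut_polys N \<Longrightarrow> (\<lambda>x z. f x z + g x z) \<in> cut_polys N"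

text \<open>The product of two cutoffs is the cutoff at the larger of the two thresholds.\<close>

lemma cut_mono_mult:
  assumes "h \<in> pw_qpolys N" "u \<in> lin_terms N" "h' \<in> pw_qpolys N" "u' \<in> lin_terms N"
  shows "(\<lambda>x z. (h x * of_int z ^ k * of_bool (u x \<le> z)) * (h' x * of_int z ^ k' * of_bool (u' x \<le> z)))
    \<in> cut_polys N"
proof -
  have 1: "(\<lambda>x. h x * h' x * of_bool (u' x \<le> u x)) \<in> pw_qpolys N"
    "(\<lambda>x. h x * h' x * of_bool (u x < u' x)) \<in> pw_qpolys N"
    using assms by (auto intro!: pw_mult pw_le pw_less)
  have "(\<lambda>x z. (h x * of_int z ^ k * of_bool (u x \<le> z)) * (h' x * of_int z ^ k' * of_bool (u' x \<le> z)))
    = (\<lambda>x z. (h x * h' x * of_bool (u' x \<le> u x)) * of_int z ^ (k + k') * of_bool (u x \<le> z)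
        + (h x * h' x * of_bool (u x < u' x)) * of_int z ^ (k + k') * of_bool (u' x \<le> z))"
    by (auto simp: fun_eq_iff power_add)
  also have "\<dots> \<in> cut_polys N"
    by (intro cut_add cut_mono 1 assms)
  finally show ?thesis .
qed

lemma cut_mult:
  assumes "f \<in> cut_polys N" "g \<in> cut_polys N"
  shows "(\<lambda>x z. f x z * g x z) \<in> cut_polys N"
  using assms
proof (induction rule: cut_polys.induct)
  case (cut_mono h u k)
  from cut_mono(3) show ?case
  proof (induction rule: cut_polys.induct)
    case (cut_mono h' u' k')
    then show ?case using cut_mono_mult \<open>h \<in> _\<close> \<open>u \<in> _\<close> by blast
  next
    case (cut_add f g)
    from cut_polys.cut_add[OF cut_add.IH] show ?case by (simp add: algebra_simps)
  qed
next
  case (cut_add f f')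
  from cut_polys.cut_add[OF cut_add.IH(1)[OF cut_add.prems] cut_add.IH(2)[OF cut_add.prems]]
  show ?case by (simp add: algebra_simps)
qed

text \<open>Agreement is only required for \<open>z \<ge> 0\<close>, where the constant \<open>1\<close> is a cutoff at \<open>0\<close>.\<close>

definition eq_cut :: "nat \<Rightarrow> ((nat \<Rightarrow> int) \<Rightarrow> int \<Rightarrow> rat) \<Rightarrow> bool" where
  "eq_cut N f \<longleftrightarrow> (\<exists>g\<in>cut_polys N. \<forall>x. \<forall>z\<ge>0. f x z = g x z)"

lemma eq_cut_add:
  assumes "eq_cut N f" "eq_cut N g"
  shows "eq_cut N (\<lambda>x z. f x z + g x z)"
proof -
  obtain f' g' where "f' \<in> cut_polys N" "g' \<in> cut_polys N"
    "\<forall>x. \<forall>z\<ge>0. f x z = f' x z" "\<forall>x. \<forall>z\<ge>0. g x z = g' x z"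
    using assms unfolding eq_cut_def by blast
  then show ?thesis
    unfolding eq_cut_def by (intro bexI[OF _ cut_add[of f' N g']]) simp_all
qed

lemma eq_cut_mult:
  assumes "eq_cut N f" "eq_cut N g"
  shows "eq_cut N (\<lambda>x z. f x z * g x z)"
proof -
  obtain f' g' where "f' \<in> cut_polys N" "g' \<in> cut_polys N"
    "\<forall>x. \<forall>z\<ge>0. f x z = f' x z" "\<forall>x. \<forall>z\<ge>0. g x z = g' x z"
    using assms unfolding eq_cut_def by blast
  then show ?thesis
    unfolding eq_cut_def by (intro bexI[OF _ cut_mult[of f' N g']]) simp_all
qed

lemma eq_cut_free: "h \<in> pw_qpolys N \<Longrightarrow> eq_cut N (\<lambda>x z. h x)"
  unfolding eq_cut_def
  by (rule bexI[OF _ cut_mono[of h N "\<lambda>_. 0" 0]]) (auto intro: lin_const)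

lemma eq_cut_var: "eq_cut N (\<lambda>x z. of_int z)"
  unfolding eq_cut_def
  by (rule bexI[OF _ cut_mono[of "\<lambda>_. 1" N "\<lambda>_. 0" 1]]) (auto intro: lin_const pw_const)

lemma eq_cut_ge: "u \<in> lin_terms N \<Longrightarrow> eq_cut N (\<lambda>x z. of_bool (u x \<le> z))"
  unfolding eq_cut_def
  by (rule bexI[OF _ cut_mono[of "\<lambda>_. 1" N u 0]]) (auto intro: pw_const)

lemma eq_cut_affine:
  assumes "u \<in> lin_terms N"
  shows "eq_cut N (\<lambda>x z. of_int (a * z + u x))"
  using eq_cut_add[OF eq_cut_mult[OF eq_cut_free[OF pw_const[of "of_int a"]] eq_cut_var]
      eq_cut_free[OF pw_term[OF assms]]] by simp

text \<open>Solving for \<open>z\<close> gives a lower threshold if \<open>a > 0\<close> and an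
  upper one if \<open>a < 0\<close>; the latter is one minus a cutoff. The thresholds are built from
  \<open>u x div \<bar>a\<bar>\<close>, which is why terms must include floor division.\<close>

lemma eq_cut_affine_ge_0:
  assumes u: "u \<in> lin_terms N"
  shows "eq_cut N (\<lambda>x z. of_bool (a * z + u x \<ge> 0))"
proof (cases a "0 :: int" rule: linorder_cases)
  case equal
  then show ?thesis using eq_cut_free[OF pw_ge_0[OF u]] by simp
next
  case greater
  have "a * z + t \<ge> 0 \<longleftrightarrow> -1 * (t div a) \<le> z" for z t
  proof -
    have "a * z + t \<ge> 0 \<longleftrightarrow> (t + a * z) div a \<ge> 0"
      using greater by (subst pos_imp_zdiv_nonneg_iff) (simp_all add: add.commute)
    also have "(t + a * z) div a = z + t div a" using greater by simp
    finally show ?thesis by linarith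
  qed
  then show ?thesis
    using eq_cut_ge[OF lin_scale[OF lin_div[OF u greater], of "-1"]] by simp
next
  case less
  have "of_bool (a * z + t \<ge> 0) = (1 :: rat) + (-1) * of_bool (t div (-a) + 1 \<le> z)" for z t
  proof -
    have "a * z + t \<ge> 0 \<longleftrightarrow> (t + (-a) * (-z)) div (-a) \<ge> 0"
      using less by (subst pos_imp_zdiv_nonneg_iff) (simp_all add: add.commute)
    also have "(t + (-a) * (-z)) div (-a) = -z + t div (-a)"
      using less by (subst div_mult_self2) simp_all
    finally show ?thesis by auto
  qed
  then show ?thesis
    using eq_cut_add[OF eq_cut_free[OF pw_const[of 1]] eq_cut_mult[OF eq_cut_free[OF pw_const[of "-1"]]
      eq_cut_ge[OF lin_add[OF lin_div[OF u, of "-a"] lin_const[of 1]]]]] less by simp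
qed

text \<open>With all floors in the last variable gone, a term is affine in \<open>z\<close> and an
  indicator is a cutoff or the complement of one; sums and products pass to a common multiple of the
  moduli.\<close>

lemma pw_qpolys_split:
  assumes "f \<in> pw_qpolys (Suc N)"
  shows "\<exists>M>0. \<forall>k>0. \<forall>r. eq_cut N (\<lambda>x z. f (x(N := M * k * z + r)))"
  using assms
proof induction
  case (pw_const c)
  show ?case by (auto intro!: exI[of _ 1] eq_cut_free pw_qpolys.pw_const)
next
  case (pw_term t)
  from lin_terms_split[OF this] obtain M where M: "M > 0"
    "\<forall>k>0. \<forall>r. \<exists>a. \<exists>u\<in>lin_terms N. \<forall>x z. t (x(N := M * k * z + r)) = a * z + u x"
    by (elim exE conjE)
  show ?case
  proof (intro exI[of _ M] conjI allI impI)
    fix k r :: int assume "k > 0"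
    from M(2)[rule_format, OF this, of r]
    obtain a u where "u \<in> lin_terms N" "\<And>x z. t (x(N := M * k * z + r)) = a * z + u x"
      by (elim exE bexE) metis
    then show "eq_cut N (\<lambda>x z. of_int (t (x(N := M * k * z + r))))"
      by (simp only: eq_cut_affine)
  qed (use M in auto)
next
  case (pw_ge_0 t)
  from lin_terms_split[OF this] obtain M where M: "M > 0"
    "\<forall>k>0. \<forall>r. \<exists>a. \<exists>u\<in>lin_terms N. \<forall>x z. t (x(N := M * k * z + r)) = a * z + u x"
    by (elim exE conjE)
  show ?case
  proof (intro exI[of _ M] conjI allI impI)
    fix k r :: int assume "k > 0"
    from M(2)[rule_format, OF this, of r]
    obtain a u where "u \<in> lin_terms N" "\<And>x z. t (x(N := M * k * z + r)) = a * z + u x"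
      by (elim exE bexE) metis
    then show "eq_cut N (\<lambda>x z. of_bool (t (x(N := M * k * z + r)) \<ge> 0))"
      by (simp only: eq_cut_affine_ge_0)
  qed (use M in auto)
next
  case (pw_add f g)
  from pw_add.IH(1) obtain M where M: "M > 0"
    "\<forall>k>0. \<forall>r. eq_cut N (\<lambda>x z. f (x(N := M * k * z + r)))" by (elim exE conjE)
  from pw_add.IH(2) obtain M' where M': "M' > 0"
    "\<forall>k>0. \<forall>r. eq_cut N (\<lambda>x z. g (x(N := M' * k * z + r)))" by (elim exE conjE)
  show ?case
  proof (intro exI[of _ "M * M'"] conjI allI impI)
    fix k r :: int assume "k > 0"
    have pos: "M' * k > 0" "M * k > 0" using M M' \<open>k > 0\<close> by simp_all
    have "M' * (M * k) = M * M' * k" "M * (M' * k) = M * M' * k" by simp_all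
    then show "eq_cut N (\<lambda>x z. f (x(N := M * M' * k * z + r)) + g (x(N := M * M' * k * z + r)))"
      using eq_cut_add[OF M(2)[rule_format, OF pos(1), of r] M'(2)[rule_format, OF pos(2), of r]] by (simp only:)
  qed (use M M' in auto)
next
  case (pw_mult f g)
  from pw_mult.IH(1) obtain M where M: "M > 0"
    "\<forall>k>0. \<forall>r. eq_cut N (\<lambda>x z. f (x(N := M * k * z + r)))" by (elim exE conjE)
  from pw_mult.IH(2) obtain M' where M': "M' > 0"
    "\<forall>k>0. \<forall>r. eq_cut N (\<lambda>x z. g (x(N := M' * k * z + r)))" by (elim exE conjE)
  show ?case
  proof (intro exI[of _ "M * M'"] conjI allI impI)
    fix k r :: int assume "k > 0"
    have pos: "M' * k > 0" "M * k > 0" using M M' \<open>k > 0\<close> by simp_all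
    have "M' * (M * k) = M * M' * k" "M * (M' * k) = M * M' * k" by simp_all
    then show "eq_cut N (\<lambda>x z. f (x(N := M * M' * k * z + r)) * g (x(N := M * M' * k * z + r)))"
      using eq_cut_mult[OF M(2)[rule_format, OF pos(1), of r] M'(2)[rule_format, OF pos(2), of r]] by (simp only:)
  qed (use M M' in auto)
qed

section \<open>Summation over one variable and over a box\<close>

text \<open>The difference of \<open>x ^ Suc k\<close> is \<open>Suc k * x ^ k\<close> plus lower
  powers, by the binomial theorem. Strong induction removes the lower powers, and characteristic
  zero permits division by \<open>Suc k\<close>.\<close>

lemma ex_antidifference_power:
  "\<exists>p :: 'a :: field_char_0 poly. \<forall>x. poly p (x + 1) - poly p x = x ^ k"
proof (induction k rule: less_induct)
  case (less k)
  then obtain q :: "nat \<Rightarrow> 'a poly" where q: "\<And>j x. j < k \<Longrightarrow> poly (q j) (x + 1) - poly (q j) x = x ^ j"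
    by metis
  define p where "p = smult (1 / of_nat (Suc k))
    (monom 1 (Suc k) - (\<Sum>j<k. smult (of_nat (Suc k choose j)) (q j)))"
  have "poly p (x + 1) - poly p x = x ^ k" for x
  proof -
    have "(x + 1) ^ Suc k = (\<Sum>j\<le>Suc k. of_nat (Suc k choose j) * x ^ j)"
      by (subst binomial_ring) simp
    also have "\<dots> = (\<Sum>j<k. of_nat (Suc k choose j) * x ^ j) + of_nat (Suc k) * x ^ k + x ^ Suc k"
      by (simp add: lessThan_Suc_atMost[symmetric] del: of_nat_Suc)
    finally have 1: "(x + 1) ^ Suc k - x ^ Suc k - (\<Sum>j<k. of_nat (Suc k choose j) * x ^ j) = of_nat (Suc k) * x ^ k"
      by (simp del: of_nat_Suc power_Suc)
    have "(\<Sum>j<k. of_nat (Suc k choose j) * x ^ j) =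
      (\<Sum>j<k. of_nat (Suc k choose j) * poly (q j) (x + 1)) - (\<Sum>j<k. of_nat (Suc k choose j) * poly (q j) x)"
      by (simp add: q[symmetric] sum_subtractf[symmetric] algebra_simps)
    with 1 have "(x + 1) ^ Suc k - x ^ Suc k - ((\<Sum>j<k. of_nat (Suc k choose j) * poly (q j) (x + 1))
      - (\<Sum>j<k. of_nat (Suc k choose j) * poly (q j) x)) = of_nat (Suc k) * x ^ k"
      by (simp only:)
    moreover have "poly p (x + 1) - poly p x = (1 / of_nat (Suc k)) * ((x + 1) ^ Suc k - x ^ Suc k
      - ((\<Sum>j<k. of_nat (Suc k choose j) * poly (q j) (x + 1)) - (\<Sum>j<k. of_nat (Suc k choose j) * poly (q j) x)))"
      by (simp add: p_def poly_monom poly_sum diff_divide_distrib del: of_nat_Suc power_Suc)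
    ultimately have "poly p (x + 1) - poly p x = (1 / of_nat (Suc k)) * (of_nat (Suc k) * x ^ k)"
      by (simp only:)
    then show ?thesis by (simp del: of_nat_Suc)
  qed
  then show ?case by blast
qed

text \<open>Telescoping. The restriction \<open>a \<le> b\<close> matters: beyond it the sum is
  empty while the difference of values need not vanish.\<close>

lemma ex_poly_sum_powers:
  "\<exists>p :: rat poly. \<forall>a b. a \<le> b \<longrightarrow>
    (\<Sum>z\<in>{a..<b}. of_int z ^ k) = poly p (of_int b) - poly p (of_int a)"
proof -
  obtain p :: "rat poly" where p: "\<And>x. poly p (x + 1) - poly p x = x ^ k"
    using ex_antidifference_power by blast
  have "(\<Sum>z\<in>{a..<b}. of_int z ^ k) = poly p (of_int b) - poly p (of_int a)" if "a \<le> b" for a b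
    using that
  proof (induction b rule: int_ge_induct)
    case (step i)
    have "{a..<i + 1} = insert i {a..<i}" using step by auto
    with step p[of "of_int i"] show ?case by simp
  qed simp
  then show ?thesis by blast
qed

lemma sum_cut_polys:
  assumes "g \<in> cut_polys N" "w \<in> lin_terms N"
  shows "(\<lambda>x. \<Sum>z\<in>{0..<w x}. g x z) \<in> pw_qpolys N"
  using assms(1)
proof induction
  case (cut_mono h u k)
  obtain p :: "rat poly" where p: "\<And>a b. a \<le> b \<Longrightarrow>
    (\<Sum>z\<in>{a..<b}. of_int z ^ k) = poly p (of_int b) - poly p (of_int a)"
    using ex_poly_sum_powers by blast
  \<comment> \<open>The sum effectively runs from \<open>max 0 (u x)\<close> to \<open>w x\<close>.
    The two summands separate the cases by which lower end is larger; the factors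
    \<open>0 \<le> w x\<close> and \<open>u x \<le> w x\<close> give the value 0 where the
    telescoped difference would be wrong.\<close>
  define W where "W = (\<lambda>x. h x *
    (of_bool (0 \<le> w x) * of_bool (u x \<le> 0) * (poly p (of_int (w x)) - poly p 0)
      + of_bool (0 < u x) * of_bool (u x \<le> w x) * (poly p (of_int (w x)) - poly p (of_int (u x)))))"
  have "(\<Sum>z\<in>{0..<w x}. h x * of_int z ^ k * of_bool (u x \<le> z)) = W x" for x
  proof -
    have "(\<Sum>z\<in>{0..<w x}. h x * of_int z ^ k * of_bool (u x \<le> z))
      = h x * (\<Sum>z\<in>{0..<w x}. of_int z ^ k * of_bool (u x \<le> z))"
      unfolding sum_distrib_left mult.assoc ..
    also have "(\<Sum>z\<in>{0..<w x}. of_int z ^ k * of_bool (u x \<le> z)) = (\<Sum>z\<in>{max 0 (u x)..<w x}. of_int z ^ k)"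
      by (rule sum.mono_neutral_cong_right) auto
    finally show ?thesis using p[of "max 0 (u x)" "w x"]
      by (auto simp: W_def max_def)
  qed
  moreover have "W \<in> pw_qpolys N"
    unfolding W_def using cut_mono assms(2)
    by (intro pw_mult pw_add pw_le pw_less pw_diff pw_poly lin_const pw_const) auto
  ultimately show ?case by simp
next
  case (cut_add f g)
  from pw_add[OF cut_add.IH] show ?case by (simp add: sum.distrib)
qed

text \<open>Writes \<open>v = M * z + r\<close>. The condition \<open>v < n\<close> becomes
  \<open>z \<le> (n - 1 - r) div M\<close>, so the new upper limit is again a term with floor
  division.\<close>

lemma sum_residue_classes:
  fixes f :: "int \<Rightarrow> 'a :: comm_monoid_add"
  assumes "M > 0"
  shows "(\<Sum>v\<in>{0..<n}. f v) = (\<Sum>r\<in>{0..<M}. \<Sum>z\<in>{0..<(n - 1 - r) div M + 1}. f (M * z + r))"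
proof -
  have *: "M * z + r < n \<longleftrightarrow> z < (n - 1 - r) div M + 1" for z r
  proof -
    have "M * z + r < n \<longleftrightarrow> 0 \<le> ((n - 1 - r) + M * (-z)) div M"
      using assms by (auto simp add: pos_imp_zdiv_nonneg_iff)
    also have "((n - 1 - r) + M * (-z)) div M = -z + (n - 1 - r) div M"
      using assms by (subst div_mult_self2) simp_all
    finally show ?thesis by auto
  qed
  have "(\<Sum>r\<in>{0..<M}. \<Sum>z\<in>{0..<(n - 1 - r) div M + 1}. f (M * z + r))
    = (\<Sum>(r, z)\<in>(SIGMA r:{0..<M}. {0..<(n - 1 - r) div M + 1}). f (M * z + r))"
    by (rule sum.Sigma) auto
  also have "\<dots> = (\<Sum>v\<in>{0..<n}. f v)"
  proof (rule sum.reindex_bij_witness[of _ "\<lambda>v. (v mod M, v div M)" "\<lambda>(r, z). M * z + r"], goal_cases)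
    case (4 v)
    have "M * (v div M) + v mod M = v" by simp
    then have "v div M < (n - 1 - v mod M) div M + 1"
      using *[of "v div M" "v mod M"] 4 by auto
    moreover have "v div M \<ge> 0"
      using 4 assms by (subst pos_imp_zdiv_nonneg_iff) auto
    ultimately show ?case using assms by simp
  qed (use assms * in \<open>auto simp: mult_nonneg_nonneg\<close>)
  finally show ?thesis by simp
qed

text \<open>On each residue class the summand is a cutoff polynomial in \<open>z \<ge> 0\<close>, to
  be summed up to a floor term. The condition \<open>N > 0\<close> keeps the summation variable
  distinct from the parameter \<open>x 0\<close>.\<close>

lemma pw_sum_last_var:
  assumes f: "f \<in> pw_qpolys (Suc N)" and "N > 0"
  shows "(\<lambda>x. \<Sum>v\<in>{0..<x 0}. f (x(N := v))) \<in> pw_qpolys N"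
proof -
  obtain M where "M > 0" and "\<And>k r. k > 0 \<Longrightarrow> eq_cut N (\<lambda>x z. f (x(N := M * k * z + r)))"
    using pw_qpolys_split[OF f] by blast
  from this(2)[of 1] have "\<forall>r. \<exists>g\<in>cut_polys N. \<forall>x. \<forall>z\<ge>0. f (x(N := M * z + r)) = g x z"
    by (simp add: eq_cut_def)
  then obtain g where g: "\<And>r. g r \<in> cut_polys N" "\<And>r x z. z \<ge> 0 \<Longrightarrow> f (x(N := M * z + r)) = g r x z"
    by metis
  have "(\<lambda>x. \<Sum>v\<in>{0..<x 0}. f (x(N := v)))
    = (\<lambda>x. \<Sum>r\<in>{0..<M}. \<Sum>z\<in>{0..<(x 0 - 1 - r) div M + 1}. g r x z)"
    by (subst sum_residue_classes[OF \<open>M > 0\<close>]) (auto simp: g(2) intro!: ext sum.cong)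
  also have "\<dots> \<in> pw_qpolys N"
    using \<open>N > 0\<close> \<open>M > 0\<close>
    by (intro pw_sum sum_cut_polys g lin_add lin_div lin_diff lin_var lin_const) auto
  finally show ?thesis .
qed

lemma sum_PiE_insert:
  assumes "a \<notin> S"
  shows "(\<Sum>y\<in>Pi\<^sub>E (insert a S) B. f y) = (\<Sum>y\<in>Pi\<^sub>E S B. \<Sum>v\<in>B a. f (y(a := v)))"
proof -
  have "(\<Sum>y\<in>Pi\<^sub>E (insert a S) B. f y) = (\<Sum>(v, y)\<in>B a \<times> Pi\<^sub>E S B. f (y(a := v)))"
    unfolding PiE_insert_eq using inj_combinator[OF assms, of B]
    by (subst sum.reindex) (auto simp: o_def case_prod_unfold)
  also have "\<dots> = (\<Sum>v\<in>B a. \<Sum>y\<in>Pi\<^sub>E S B. f (y(a := v)))"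
    by (rule sum.cartesian_product[symmetric])
  finally show ?thesis by (simp add: sum.swap[of _ "B a"])
qed

text \<open>Variables are summed out from the last one downwards. Functions in the box are
  \<open>undefined\<close> outside \<open>{1..L}\<close>, so the parameter has to be written into
  slot 0.\<close>

lemma pw_sum_box:
  assumes "f \<in> pw_qpolys (Suc L)"
  shows "(\<lambda>x. \<Sum>y\<in>{1..L} \<rightarrow>\<^sub>E {0..<x 0}. f (y(0 := x 0))) \<in> pw_qpolys 1"
  using assms
proof (induction L arbitrary: f)
  case 0
  \<comment> \<open>Without digits the box consists of the everywhere \<open>undefined\<close>
    function, and \<open>f\<close> reads only slot 0.\<close>
  have "f ((\<lambda>_. undefined)(0 := x 0)) = f x" for x
    by (rule pw_qpolys_cong[OF 0]) simp
  then have "(\<lambda>x. f ((\<lambda>_. undefined)(0 := x 0))) = f" by (rule ext)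
  with 0 show ?case by (simp del: fun_upd_apply)
next
  case (Suc L)
  have "{1..Suc L} = insert (Suc L) {1..L}" by auto
  then have "(\<Sum>y\<in>{1..Suc L} \<rightarrow>\<^sub>E {0..<x 0}. f (y(0 := x 0)))
    = (\<Sum>y\<in>{1..L} \<rightarrow>\<^sub>E {0..<x 0}. \<Sum>v\<in>{0..<(y(0 := x 0)) 0}. f ((y(0 := x 0))(Suc L := v)))" for x :: "nat \<Rightarrow> int"
    by (simp add: sum_PiE_insert fun_upd_twist)
  with Suc.IH[OF pw_sum_last_var[OF Suc.prems]] show ?case by (simp only: zero_less_Suc)
qed

section \<open>Functions of the parameter alone\<close>

lemma cut_polys_eventually_poly:
  assumes "g \<in> cut_polys N"
  shows "\<exists>p :: rat poly. eventually (\<lambda>z. g x z = poly p (of_int z)) at_top"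
  using assms
proof induction
  case (cut_mono h u k)
  have "eventually (\<lambda>z. h x * of_int z ^ k * of_bool (u x \<le> z) = poly (monom (h x) k) (of_int z)) at_top"
    using eventually_ge_at_top[of "u x"] by eventually_elim (simp add: poly_monom)
  then show ?case by blast
next
  case (cut_add f g)
  then obtain p q :: "rat poly" where
    "eventually (\<lambda>z. f x z = poly p (of_int z)) at_top" "eventually (\<lambda>z. g x z = poly q (of_int z)) at_top"
    by blast
  then have "eventually (\<lambda>z. f x z + g x z = poly (p + q) (of_int z)) at_top"
    by eventually_elim simp
  then show ?case by blast
qed

text \<open>The parameter itself is now split off as \<open>M * z + i\<close>. With no variables
  left, all thresholds are constants, so each residue class yields a single polynomial in
  \<open>z\<close> for large \<open>z\<close>.\<close>

lemma QP_eventually_if_pw_qpoly: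
  assumes f: "f \<in> pw_qpolys 1"
    and "eventually (\<lambda>n. rat_of_int (F n) = f (\<lambda>_. n)) at_top"
  shows "F \<in> QP_eventually"
proof -
  obtain M where M: "M > 0" and "\<And>k r. k > 0 \<Longrightarrow> eq_cut 0 (\<lambda>x z. f (x(0 := M * k * z + r)))"
    using pw_qpolys_split[of f 0] f by auto
  from this(2)[of 1] have "\<forall>r. \<exists>g\<in>cut_polys 0. \<forall>x. \<forall>z\<ge>0. f (x(0 := M * z + r)) = g x z"
    by (simp add: eq_cut_def)
  then obtain g where g: "\<And>r. g r \<in> cut_polys 0" "\<And>r x z. z \<ge> 0 \<Longrightarrow> f (x(0 := M * z + r)) = g r x z"
    by metis
  have "\<forall>r. \<exists>p :: rat poly. eventually (\<lambda>z. g r (\<lambda>_. 0) z = poly p (of_int z)) at_top"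
    by (intro allI cut_polys_eventually_poly[OF g(1)])
  from choice[OF this] obtain p :: "int \<Rightarrow> rat poly" where
    p: "\<And>r. eventually (\<lambda>z. g r (\<lambda>_. 0) z = poly (p r) (of_int z)) at_top"
    by (elim exE) blast
  \<comment> \<open>Substitutes \<open>z = (n - i) / M\<close>.\<close>
  define q where "q = (\<lambda>i::nat. pcompose (p (int i)) [:- of_nat i / of_int M, 1 / of_int M:])"
  have "eventually (\<lambda>n. [n = int i] (mod M) \<longrightarrow> rat_of_int (F n) = poly (q i) (rat_of_int n)) at_top" for i
  proof -
    obtain B where B: "\<And>z. z \<ge> B \<Longrightarrow> g (int i) (\<lambda>_. 0) z = poly (p (int i)) (of_int z)"
      using p[of "int i"] unfolding eventually_at_top_linorder by blast
    \<comment> \<open>The bound on \<open>n\<close> forces both \<open>z \<ge> B\<close>, where the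
      polynomial is valid, and \<open>z \<ge> 0\<close>, where \<open>f\<close> agrees with its
      cutoff form.\<close>
    show ?thesis
      using assms(2) eventually_ge_at_top[of "M * max B 0 + int i"]
    proof eventually_elim
      case (elim n)
      show ?case
      proof
        assume "[n = int i] (mod M)"
        then obtain z where z: "n = M * z + int i"
          by (metis cong_iff_lin cong_sym add.commute mult.commute)
        with elim have "M * max B 0 \<le> M * z" by simp
        with M have z0: "z \<ge> B" "z \<ge> 0" by (auto simp: mult_le_cancel_left_pos)
        have "rat_of_int (F n) = f ((\<lambda>_. 0)(0 := M * z + int i))"
          using elim(1) pw_qpolys_cong[OF f, of "\<lambda>_. n" "(\<lambda>_. 0)(0 := M * z + int i)"] z by simp
        also have "\<dots> = poly (p (int i)) (of_int z)" using g(2) B z0 by simp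
        also have "\<dots> = poly (q i) (of_int n)"
          using M by (simp add: q_def poly_pcompose z field_simps)
        finally show "rat_of_int (F n) = poly (q i) (rat_of_int n)" .
      qed
    qed
  qed
  then show ?thesis unfolding QP_eventually_def using M
    by (intro CollectI exI[of _ "nat M"] conjI exI[of _ q]) auto
qed

section \<open>Inequalities in base \<open>n\<close>\<close>

text \<open>Horner form of an expansion in powers of \<open>n = x 0\<close>; the nesting allows the
  sign to be found by passing one carry at a time.\<close>

inductive_set digit_forms :: "nat \<Rightarrow> ((nat \<Rightarrow> int) \<Rightarrow> int) set" for N where
  digit_zero: "(\<lambda>x. 0) \<in> digit_forms N"
| digit_step: "l \<in> lin_terms N \<Longrightarrow> g \<in> digit_forms N \<Longrightarrow> (\<lambda>x. l x + x 0 * g x) \<in> digit_forms N"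

lemma digit_term: "l \<in> lin_terms N \<Longrightarrow> l \<in> digit_forms N"
  using digit_step[OF _ digit_zero] by simp

lemma digit_shift: "g \<in> digit_forms N \<Longrightarrow> (\<lambda>x. x 0 * g x) \<in> digit_forms N"
  using digit_step[OF lin_const[of 0]] by simp

lemma digit_add:
  assumes "f \<in> digit_forms N" "g \<in> digit_forms N"
  shows "(\<lambda>x. f x + g x) \<in> digit_forms N"
  using assms
proof (induction arbitrary: g)
  case digit_zero
  then show ?case by simp
next
  case (digit_step l f)
  from digit_step.prems show ?case
  proof cases
    case digit_zero
    then show ?thesis using digit_forms.digit_step[OF digit_step.hyps] by simp
  next
    case (digit_step l' g')
    with \<open>l \<in> _\<close> have "(\<lambda>x. l x + l' x) \<in> lin_terms N" by (intro lin_add)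
    from digit_forms.digit_step[OF this \<open>\<And>g. g \<in> digit_forms N \<Longrightarrow> (\<lambda>x. f x + g x) \<in> digit_forms N\<close>[OF digit_step(3)]]
    show ?thesis using digit_step(1) by (simp add: algebra_simps)
  qed
qed

lemma digit_scale:
  assumes "g \<in> digit_forms N"
  shows "(\<lambda>x. a * g x) \<in> digit_forms N"
  using assms
proof induction
  case digit_zero
  show ?case using digit_forms.digit_zero by simp
next
  case (digit_step l g)
  from digit_forms.digit_step[OF lin_scale[OF digit_step(1), of a] digit_step.IH]
  show ?case by (simp add: algebra_simps)
qed

lemma digit_sum:
  assumes "\<And>i. i \<in> A \<Longrightarrow> g i \<in> digit_forms N"
  shows "(\<lambda>x. \<Sum>i\<in>A. g i x) \<in> digit_forms N"
  using assms by (induction A rule: infinite_finite_induct) (auto intro: digit_zero digit_add)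

lemma digit_poly_mult:
  assumes "g \<in> digit_forms N"
  shows "(\<lambda>x. poly p (x 0) * g x) \<in> digit_forms N"
proof (induction p)
  case 0
  show ?case using digit_zero by simp
next
  case (pCons a p)
  from digit_add[OF digit_scale[OF assms, of a] digit_shift[OF pCons.IH]]
  show ?case by (simp add: algebra_simps)
qed

text \<open>The upper bound is not strict, although digits are smaller than \<open>n\<close>, so
  that slot 0 itself meets it.\<close>

definition digit_box :: "nat \<Rightarrow> (nat \<Rightarrow> int) set" where
  "digit_box N = {x. x 0 > 0 \<and> (\<forall>i<N. 0 \<le> x i \<and> x i \<le> x 0)}"

text \<open>Constants are absorbed because \<open>x 0 \<ge> 1\<close>, and floor division by a
  positive integer does not increase absolute values. This is what bounds the carries.\<close>

lemma lin_terms_bound: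
  assumes "t \<in> lin_terms N"
  shows "\<exists>C\<ge>0. \<forall>x\<in>digit_box N. \<bar>t x\<bar> \<le> C * x 0"
  using assms
proof induction
  case (lin_const c)
  have "\<bar>c\<bar> \<le> \<bar>c\<bar> * x 0" if "x \<in> digit_box N" for x
    using that mult_left_mono[of 1 "x 0" "\<bar>c\<bar>"] by (simp add: digit_box_def)
  then show ?case by (intro exI[of _ "\<bar>c\<bar>"]) simp
next
  case (lin_var i)
  then show ?case by (intro exI[of _ 1]) (simp add: digit_box_def)
next
  case (lin_add s t)
  then obtain C D where "C \<ge> 0" "D \<ge> 0" "\<forall>x\<in>digit_box N. \<bar>s x\<bar> \<le> C * x 0" "\<forall>x\<in>digit_box N. \<bar>t x\<bar> \<le> D * x 0"
    by blast
  then show ?case by (intro exI[of _ "C + D"]) (fastforce simp: algebra_simps)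
next
  case (lin_scale t a)
  then obtain C where C: "C \<ge> 0" "\<forall>x\<in>digit_box N. \<bar>t x\<bar> \<le> C * x 0" by blast
  have "\<bar>a * t x\<bar> \<le> \<bar>a\<bar> * C * x 0" if "x \<in> digit_box N" for x
    using C that mult_left_mono[of "\<bar>t x\<bar>" "C * x 0" "\<bar>a\<bar>"] by (simp add: abs_mult mult.assoc)
  then show ?case using C by (intro exI[of _ "\<bar>a\<bar> * C"]) simp
next
  case (lin_div t m)
  then obtain C where C: "C \<ge> 0" "\<forall>x\<in>digit_box N. \<bar>t x\<bar> \<le> C * x 0" by blast
  have "\<bar>t x div m\<bar> \<le> \<bar>t x\<bar>" for x
  proof (cases "t x \<ge> 0")
    case True
    then show ?thesis using \<open>m > 0\<close> zdiv_mono2[of "t x" 1 m] by (simp add: pos_imp_zdiv_nonneg_iff)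
  next
    case False
    have "t x * 1 \<ge> t x * m" using False \<open>m > 0\<close> by (intro mult_left_mono_neg) auto
    then have "t x div m \<ge> t x" using \<open>m > 0\<close> zdiv_mono1[of "t x * m" "t x" m] by simp
    moreover have "t x div m < 0" using False \<open>m > 0\<close> by (simp add: pos_imp_zdiv_neg_iff)
    ultimately show ?thesis using False by simp
  qed
  then have "\<bar>t x div m\<bar> \<le> C * x 0" if "x \<in> digit_box N" for x
    using C(2) that order_trans by blast
  then show ?case using C by (intro exI[of _ C]) simp
qed

text \<open>In the inductive step \<open>l + n * g \<ge> 0\<close> iff \<open>g + l div n \<ge> 0\<close>, and the quotient \<open>l div n\<close> takes
  only boundedly many values on the box.\<close>

lemma pw_digit_form_ge_0:
  assumes "g \<in> digit_forms N" "N > 0"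
  shows "\<exists>f\<in>pw_qpolys N. \<forall>x\<in>digit_box N. f x = of_bool (g x + c \<ge> 0)"
  using assms(1)
proof (induction arbitrary: c)
  case digit_zero
  show ?case by (intro bexI[OF _ pw_const[of "of_bool (c \<ge> 0)"]]) simp
next
  case (digit_step l g)
  \<comment> \<open>The constant \<open>c\<close> is the carry from below and joins the lowest form;
    this is why the induction is over arbitrary \<open>c\<close>.\<close>
  have lc: "(\<lambda>x. l x + c) \<in> lin_terms N" (is "?l \<in> _")
    by (intro lin_add digit_step lin_const)
  then obtain C where C: "C \<ge> 0" "\<And>x. x \<in> digit_box N \<Longrightarrow> \<bar>?l x\<bar> \<le> C * x 0"
    using lin_terms_bound by blast
  have "\<forall>q. \<exists>f. f \<in> pw_qpolys N \<and> (\<forall>x\<in>digit_box N. f x = of_bool (g x + q \<ge> 0))"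
    using digit_step.IH by blast
  from choice[OF this] obtain f where
    f: "\<And>q. f q \<in> pw_qpolys N" "\<And>q x. x \<in> digit_box N \<Longrightarrow> f q x = of_bool (g x + q \<ge> 0)"
    by blast
  \<comment> \<open>Division by \<open>x 0\<close> is not a term, but for each constant
    \<open>q\<close> the condition \<open>?l x div x 0 = q\<close> amounts to two linear
    inequalities. Exactly one summand is active.\<close>
  define W where "W = (\<lambda>x. \<Sum>q\<in>{-C..C}. of_bool (q * x 0 \<le> ?l x) * of_bool (?l x < (q + 1) * x 0) * f q x)"
  have "W \<in> pw_qpolys N"
    unfolding W_def using \<open>N > 0\<close>
    by (intro pw_sum pw_mult pw_le pw_less lc lin_scale lin_var f)
  moreover have "W x = of_bool (l x + x 0 * g x + c \<ge> 0)" if x: "x \<in> digit_box N" for x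
  proof -
    have x0: "x 0 > 0" using x by (simp add: digit_box_def)
    have q: "q * x 0 \<le> ?l x \<and> ?l x < (q + 1) * x 0 \<longleftrightarrow> q = ?l x div x 0" for q
    proof
      assume "q * x 0 \<le> ?l x \<and> ?l x < (q + 1) * x 0"
      then show "q = ?l x div x 0"
        by (intro int_div_pos_eq[symmetric, of _ _ _ "?l x - q * x 0"]) (auto simp: algebra_simps)
    next
      assume "q = ?l x div x 0"
      then have "?l x = q * x 0 + ?l x mod x 0" by (simp add: div_mult_mod_eq)
      moreover have "0 \<le> ?l x mod x 0" "?l x mod x 0 < x 0" using x0 by simp_all
      ultimately show "q * x 0 \<le> ?l x \<and> ?l x < (q + 1) * x 0" by (simp only: distrib_right) linarith
    qed
    have "- C * x 0 \<le> ?l x" "?l x \<le> C * x 0" using C(2)[OF x] by simp_all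
    then have "?l x div x 0 \<le> (C * x 0) div x 0" "(- C * x 0) div x 0 \<le> ?l x div x 0"
      using x0 by (simp_all only: zdiv_mono1)
    then have mem: "?l x div x 0 \<in> {-C..C}" using x0 by (simp del: mult_minus_left)
    have "W x = (\<Sum>q\<in>{-C..C}. if q = ?l x div x 0 then f q x else 0)"
      unfolding W_def by (intro sum.cong refl) (simp add: q[symmetric])
    also have "\<dots> = f (?l x div x 0) x" using mem by simp
    also have "\<dots> = of_bool (g x + ?l x div x 0 \<ge> 0)" using f x by simp
    also have "g x + ?l x div x 0 = (?l x + x 0 * g x) div x 0" using x0 by simp
    also have "\<dots> \<ge> 0 \<longleftrightarrow> l x + x 0 * g x + c \<ge> 0"
      using x0 by (simp add: pos_imp_zdiv_nonneg_iff algebra_simps)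
    finally show ?thesis .
  qed
  ultimately show ?case by blast
qed

section \<open>Fourier-Motzkin elimination and growth of coordinates\<close>

text \<open>The order on polynomials is given by the sign of the leading coefficient. By integrality
  a positive value is at least 1, so \<open>n * poly p n \<ge> n\<close> outweighs the constant
  coefficient.\<close>

lemma eventually_poly_pos:
  fixes p :: "int poly"
  assumes "p > 0"
  shows "eventually (\<lambda>n. poly p n > 0) at_top"
  using assms
proof (induction p)
  case (pCons a p)
  show ?case
  proof (cases "p = 0")
    case True
    with pCons.prems have "a > 0" by (simp add: less_poly_def pos_poly_pCons)
    with True show ?thesis by simp
  next
    case False
    with pCons.prems have "p > 0" by (simp add: less_poly_def pos_poly_pCons)
    from pCons.IH[OF this] eventually_gt_at_top[of "\<bar>a\<bar>"] show ?thesis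
    proof eventually_elim
      case (elim n)
      then have "n * 1 \<le> n * poly p n" by (intro mult_left_mono) auto
      with elim show ?case by simp
    qed
  qed
qed simp

lemma eventually_poly_neg:
  fixes p :: "int poly"
  assumes "p < 0"
  shows "eventually (\<lambda>n. poly p n < 0) at_top"
  using eventually_poly_pos[of "-p"] assms by simp

lemma eventually_abs_poly_le_power:
  fixes p :: "int poly"
  shows "\<exists>k. eventually (\<lambda>n. \<bar>poly p n\<bar> \<le> n ^ k) at_top"
proof (induction p)
  case 0
  show ?case by (auto intro!: exI[of _ 0] always_eventually)
next
  case (pCons a p)
  then obtain k where "eventually (\<lambda>n. \<bar>poly p n\<bar> \<le> n ^ k) at_top" by blast
  \<comment> \<open>One extra factor \<open>n\<close> comes from shifting the coefficients; the
    other absorbs the 2 in \<open>\<bar>a\<bar> + n * n ^ k \<le> 2 * (n * n ^ k)\<close>.\<close>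
  then have "eventually (\<lambda>n. \<bar>poly (pCons a p) n\<bar> \<le> n ^ (k + 2)) at_top"
    using eventually_ge_at_top[of "\<bar>a\<bar> + 2"]
  proof eventually_elim
    case (elim n)
    then have n: "n \<ge> 2" by simp
    have "n * \<bar>poly p n\<bar> \<le> n * n ^ k" using elim n by (intro mult_left_mono) auto
    moreover have "n * 1 \<le> n * n ^ k" using n by (intro mult_left_mono) auto
    moreover have "2 * (n * n ^ k) \<le> n * (n * n ^ k)" using n by (intro mult_right_mono) auto
    moreover have "\<bar>a + n * poly p n\<bar> \<le> \<bar>a\<bar> + n * \<bar>poly p n\<bar>"
      using n abs_triangle_ineq[of a "n * poly p n"] by (simp add: abs_mult)
    ultimately show ?case using elim by simp
  qed
  then show ?case by blast
qed

section \<open>Elimination of variables\<close>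

text \<open>Take the largest lower bound, or the smallest upper bound if there are no lower ones.
  This supplies the value of an eliminated variable.\<close>

lemma ex_between_finite:
  fixes A B :: "'a :: linorder set"
  assumes "finite A" "finite B" "\<And>a b. a \<in> A \<Longrightarrow> b \<in> B \<Longrightarrow> a \<le> b"
  shows "\<exists>v. (\<forall>a\<in>A. a \<le> v) \<and> (\<forall>b\<in>B. v \<le> b)"
proof (cases "A = {}")
  case True
  show ?thesis
  proof (cases "B = {}")
    case False
    with True assms show ?thesis by (intro exI[of _ "Min B"]) auto
  qed (use True in simp)
next
  case False
  with assms show ?thesis by (intro exI[of _ "Max A"]) auto
qed

text \<open>Coefficients stay polynomials in \<open>n\<close>, so that one elimination serves all
  large \<open>n\<close> at once.\<close>

type_synonym 'd constraint = "('d \<Rightarrow> int poly) \<times> int poly"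

text \<open>Points are plain functions rather than vectors, so that a coordinate can be changed by
  function update.\<close>

definition satisfies :: "int \<Rightarrow> ('d::finite \<Rightarrow> real) \<Rightarrow> 'd constraint \<Rightarrow> bool" where
  "satisfies n x c \<longleftrightarrow> (\<Sum>i\<in>UNIV. of_int (poly (fst c i) n) * x i) \<ge> of_int (poly (snd c) n)"

lemma satisfies_fun_upd:
  fixes x :: "'d::finite \<Rightarrow> real"
  shows "satisfies n (x(j := v)) c \<longleftrightarrow> of_int (poly (fst c j) n) * v
    \<ge> of_int (poly (snd c) n) - (\<Sum>i\<in>UNIV - {j}. of_int (poly (fst c i) n) * x i)"
proof -
  have "(\<Sum>i\<in>UNIV. of_int (poly (fst c i) n) * (x(j := v)) i)
    = of_int (poly (fst c j) n) * v + (\<Sum>i\<in>UNIV - {j}. of_int (poly (fst c i) n) * x i)"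
    by (subst sum.remove[of _ j]) (auto intro!: sum.cong)
  then show ?thesis unfolding satisfies_def by linarith
qed

text \<open>For \<open>fst p j > 0\<close> and \<open>fst q j < 0\<close> this is a positive
  combination of the two inequalities in which variable \<open>j\<close> cancels. It avoids division
  and thus remains over the integer polynomials.\<close>

definition combine :: "'d \<Rightarrow> 'd constraint \<Rightarrow> 'd constraint \<Rightarrow> 'd constraint" where
  "combine j p q = (\<lambda>i. fst p j * fst q i - fst q j * fst p i, fst p j * snd q - fst q j * snd p)"

definition eliminate :: "'d \<Rightarrow> 'd constraint set \<Rightarrow> 'd constraint set" where
  "eliminate j C = {c\<in>C. fst c j = 0} \<union>
    (\<lambda>(p, q). combine j p q) ` ({p\<in>C. fst p j > 0} \<times> {q\<in>C. fst q j < 0})"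

lemma finite_eliminate: "finite C \<Longrightarrow> finite (eliminate j C)"
  by (simp add: eliminate_def)

lemma eliminate_coeff_self: "c \<in> eliminate j C \<Longrightarrow> fst c j = 0"
  by (auto simp: eliminate_def combine_def)

lemma eliminate_coeff_other: "\<forall>c\<in>C. fst c i = 0 \<Longrightarrow> c \<in> eliminate j C \<Longrightarrow> fst c i = 0"
  unfolding eliminate_def combine_def by (elim UnE imageE) (simp_all add: case_prod_unfold mem_Times_iff)

text \<open>For large \<open>n\<close> the value of each coefficient of variable \<open>j\<close>
  has the sign of the polynomial, so that the choice of pairs made in \<open>eliminate\<close> is
  the right one for the real system at \<open>n\<close>.\<close>

lemma eventually_eliminate:
  fixes C :: "'d::finite constraint set"
  assumes "finite C"
  shows "eventually (\<lambda>n. \<forall>x. (\<exists>v. \<forall>c\<in>C. satisfies n (x(j := v)) c) \<longleftrightarrow>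
    (\<forall>c\<in>eliminate j C. satisfies n x c)) at_top"
proof -
  have "eventually (\<lambda>n. \<forall>c\<in>C. (fst c j > 0 \<longrightarrow> poly (fst c j) n > 0)
    \<and> (fst c j < 0 \<longrightarrow> poly (fst c j) n < 0)) at_top"
    using assms eventually_poly_pos eventually_poly_neg
    by (intro eventually_ball_finite ballI eventually_conj) (auto simp: eventually_conj_iff intro: eventually_mono)
  then show ?thesis
  proof eventually_elim
    case (elim n)
    define a where "a = (\<lambda>c :: 'd constraint. real_of_int (poly (fst c j) n))"
    show ?case
    proof
      fix x :: "'d \<Rightarrow> real"
      define b where "b = (\<lambda>c. of_int (poly (snd c) n) - (\<Sum>i\<in>UNIV - {j}. of_int (poly (fst c i) n) * x i))"
      have sat: "satisfies n (x(j := v)) c \<longleftrightarrow> a c * v \<ge> b c" for v c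
        unfolding a_def b_def by (rule satisfies_fun_upd)
      have sat': "satisfies n x c \<longleftrightarrow> a c * x j \<ge> b c" for c
        using sat[of "x j" c] by simp
      have comb: "a (combine j p q) = 0" "b (combine j p q) = a p * b q - a q * b p" for p q
        by (auto simp: a_def b_def combine_def algebra_simps sum_subtractf sum_distrib_left)
      have pos: "a c > 0" if "c \<in> C" "fst c j > 0" for c using elim that by (simp add: a_def)
      have neg: "a c < 0" if "c \<in> C" "fst c j < 0" for c using elim that by (simp add: a_def)
      have zero: "a c = 0" if "fst c j = 0" for c using that by (simp add: a_def)
      show "(\<exists>v. \<forall>c\<in>C. satisfies n (x(j := v)) c) \<longleftrightarrow> (\<forall>c\<in>eliminate j C. satisfies n x c)"
      proof
        assume "\<exists>v. \<forall>c\<in>C. satisfies n (x(j := v)) c"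
        then obtain v where v: "\<And>c. c \<in> C \<Longrightarrow> a c * v \<ge> b c" using sat by blast
        have "b (combine j p q) \<le> 0"
          if "p \<in> C" "q \<in> C" "fst p j > 0" "fst q j < 0" for p q
        proof -
          have "a p * b q \<le> a p * (a q * v)" using v that pos by (intro mult_left_mono) (auto simp: less_imp_le)
          moreover have "a q * (a p * v) \<le> a q * b p" using v that neg by (intro mult_left_mono_neg) (auto simp: less_imp_le)
          ultimately show ?thesis by (simp add: comb algebra_simps)
        qed
        then show "\<forall>c\<in>eliminate j C. satisfies n x c"
          using v zero by (fastforce simp: eliminate_def sat' comb)
      next
        assume R: "\<forall>c\<in>eliminate j C. satisfies n x c"
        \<comment> \<open>Positive coefficients give lower bounds for \<open>v\<close>, negative
          ones upper bounds.\<close>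
        define A B where "A = (\<lambda>c. b c / a c) ` {p\<in>C. fst p j > 0}" and "B = (\<lambda>c. b c / a c) ` {q\<in>C. fst q j < 0}"
        have "\<exists>v. (\<forall>a\<in>A. a \<le> v) \<and> (\<forall>b\<in>B. v \<le> b)"
        proof (rule ex_between_finite)
          fix l u assume "l \<in> A" "u \<in> B"
          then obtain p q where pq: "p \<in> C" "fst p j > 0" "l = b p / a p" "q \<in> C" "fst q j < 0" "u = b q / a q"
            by (auto simp: A_def B_def)
          then have "combine j p q \<in> eliminate j C" by (auto simp: eliminate_def)
          with R have "a p * b q \<le> a q * b p" by (auto simp: sat' comb)
          moreover have "b p = a p * l" "b q = a q * u" using pos[of p] neg[of q] pq by simp_all
          \<comment> \<open>The common factor is negative, so cancelling it reverses the
            inequality.\<close>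
          ultimately have "(a p * a q) * u \<le> (a p * a q) * l" by (simp add: mult_ac)
          moreover have "a p * a q < 0" using pos[of p] neg[of q] pq by (simp add: mult_pos_neg)
          ultimately show "l \<le> u" by (simp only: mult_le_cancel_left_neg)
        qed (use assms in \<open>auto simp: A_def B_def\<close>)
        then obtain v where v: "\<And>l. l \<in> A \<Longrightarrow> l \<le> v" "\<And>u. u \<in> B \<Longrightarrow> v \<le> u" by blast
        have "a c * v \<ge> b c" if c: "c \<in> C" for c
        proof (cases "fst c j" "0 :: int poly" rule: linorder_cases)
          case less
          then have "v \<le> b c / a c" using c by (intro v(2)) (auto simp: B_def)
          then show ?thesis using neg[OF c less] by (simp add: field_simps)
        next
          case equal
          then have "satisfies n x c" using c R by (auto simp: eliminate_def)
          then show ?thesis using equal zero by (simp add: sat')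
        next
          case greater
          then have "b c / a c \<le> v" using c by (intro v(1)) (auto simp: A_def)
          then show ?thesis using pos[OF c greater] by (simp add: field_simps)
        qed
        then show "\<exists>v. \<forall>c\<in>C. satisfies n (x(j := v)) c" using sat by blast
      qed
    qed
  qed
qed

text \<open>Eliminates the variables of \<open>J\<close> one at a time; later eliminations do not
  bring back variables already removed.\<close>

lemma eventually_projection:
  fixes C :: "'d::finite constraint set"
  assumes "finite J" "finite C"
  shows "\<exists>D. finite D \<and> (\<forall>c\<in>D. \<forall>j\<in>J. fst c j = 0) \<and>
    eventually (\<lambda>n. \<forall>x. (\<exists>y. (\<forall>i. i \<notin> J \<longrightarrow> y i = x i) \<and> (\<forall>c\<in>C. satisfies n y c)) \<longleftrightarrow>
      (\<forall>c\<in>D. satisfies n x c)) at_top"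
  using assms(1)
proof induction
  case empty
  have "(\<forall>i. y i = x i) \<longleftrightarrow> y = x" for x y :: "'d \<Rightarrow> real" by auto
  then show ?case using assms(2) by (intro exI[of _ C]) simp
next
  case (insert j J)
  then obtain D where D: "finite D" "\<forall>c\<in>D. \<forall>j\<in>J. fst c j = 0"
    "eventually (\<lambda>n. \<forall>x. (\<exists>y. (\<forall>i. i \<notin> J \<longrightarrow> y i = x i) \<and> (\<forall>c\<in>C. satisfies n y c)) \<longleftrightarrow>
      (\<forall>c\<in>D. satisfies n x c)) at_top" by (elim exE conjE)
  have "eventually (\<lambda>n. \<forall>x. (\<exists>y. (\<forall>i. i \<notin> insert j J \<longrightarrow> y i = x i) \<and> (\<forall>c\<in>C. satisfies n y c)) \<longleftrightarrow>
      (\<forall>c\<in>eliminate j D. satisfies n x c)) at_top"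
    using D(3) eventually_eliminate[OF D(1), of j]
  proof eventually_elim
    case (elim n)
    have "(\<exists>y. (\<forall>i. i \<notin> insert j J \<longrightarrow> y i = x i) \<and> (\<forall>c\<in>C. satisfies n y c)) \<longleftrightarrow>
      (\<exists>v. \<exists>y. (\<forall>i. i \<notin> J \<longrightarrow> y i = (x(j := v)) i) \<and> (\<forall>c\<in>C. satisfies n y c))" (is "?l \<longleftrightarrow> ?r") for x
    proof
      assume ?l
      then obtain y where y: "\<forall>i. i \<notin> insert j J \<longrightarrow> y i = x i" "\<forall>c\<in>C. satisfies n y c" by blast
      then show ?r by (intro exI[of _ "y j"] exI[of _ y]) auto
    next
      assume ?r
      then obtain v y where "\<forall>i. i \<notin> J \<longrightarrow> y i = (x(j := v)) i" "\<forall>c\<in>C. satisfies n y c" by blast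
      then show ?l by (intro exI[of _ y]) auto
    qed
    also have "(\<exists>v. \<exists>y. (\<forall>i. i \<notin> J \<longrightarrow> y i = (x(j := v)) i) \<and> (\<forall>c\<in>C. satisfies n y c))
      \<longleftrightarrow> (\<exists>v. \<forall>c\<in>D. satisfies n (x(j := v)) c)" for x
      by (intro ex_cong1 elim(1)[rule_format])
    also have "(\<exists>v. \<forall>c\<in>D. satisfies n (x(j := v)) c) \<longleftrightarrow> (\<forall>c\<in>eliminate j D. satisfies n x c)" for x
      by (rule elim(2)[rule_format])
    finally show ?case by (rule allI)
  qed
  moreover have "\<forall>c\<in>eliminate j D. \<forall>i\<in>insert j J. fst c i = 0"
    using D(2) by (auto intro: eliminate_coeff_self eliminate_coeff_other[of D])
  ultimately show ?case using finite_eliminate[OF D(1)] by (intro exI[of _ "eliminate j D"] conjI)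
qed

text \<open>Projection to coordinate \<open>j\<close> leaves finitely many inequalities
  \<open>a * x j \<ge> b\<close>. If there is a solution, boundedness forces both signs of
  \<open>a\<close> to occur. A nonzero integer \<open>a\<close> has absolute value at least 1, so a
  power of \<open>n\<close> bounding all \<open>\<bar>b\<bar>\<close> also bounds
  \<open>\<bar>x j\<bar>\<close>.\<close>

lemma eventually_coordinate_bound:
  fixes C :: "'d::finite constraint set"
  assumes "finite C"
    and bdd: "eventually (\<lambda>n. bounded ((\<lambda>x. x j) ` {x. \<forall>c\<in>C. satisfies n x c})) at_top"
  shows "\<exists>k. eventually (\<lambda>n. \<forall>x. (\<forall>c\<in>C. satisfies n x c) \<longrightarrow> \<bar>x j\<bar> \<le> of_int n ^ k) at_top"
proof -
  obtain D where D: "finite D" "\<forall>c\<in>D. \<forall>i\<in>UNIV - {j}. fst c i = 0"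
    "eventually (\<lambda>n. \<forall>x. (\<exists>y. (\<forall>i. i \<notin> UNIV - {j} \<longrightarrow> y i = x i) \<and> (\<forall>c\<in>C. satisfies n y c)) \<longleftrightarrow>
      (\<forall>c\<in>D. satisfies n x c)) at_top"
    using eventually_projection[OF finite \<open>finite C\<close>, of "UNIV - {j}"] by (elim exE conjE)
  have "\<forall>c :: 'd constraint. \<exists>k. eventually (\<lambda>n. \<bar>poly (snd c) n\<bar> \<le> n ^ k) at_top"
    by (intro allI eventually_abs_poly_le_power)
  from choice[OF this] obtain kk where
    kk: "\<And>c :: 'd constraint. eventually (\<lambda>n. \<bar>poly (snd c) n\<bar> \<le> n ^ kk c) at_top"
    by blast
  \<comment> \<open>For empty \<open>D\<close> this exponent is unspecified; the bound is then
    vacuous, as any solution leads below to a member of \<open>D\<close>.\<close>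
  define k where "k = Max (kk ` D)"
  have "eventually (\<lambda>n. \<forall>c\<in>D. \<bar>poly (snd c) n\<bar> \<le> n ^ kk c) at_top"
    using D(1) kk by (intro eventually_ball_finite) auto
  then have "eventually (\<lambda>n. \<forall>x. (\<forall>c\<in>C. satisfies n x c) \<longrightarrow> \<bar>x j\<bar> \<le> of_int n ^ k) at_top"
    using D(3) bdd eventually_ge_at_top[of 1]
  proof eventually_elim
    case (elim n)
    define a where "a = (\<lambda>c :: 'd constraint. real_of_int (poly (fst c j) n))"
    define b where "b = (\<lambda>c :: 'd constraint. real_of_int (poly (snd c) n))"
    have sat: "satisfies n x c \<longleftrightarrow> a c * x j \<ge> b c" if "c \<in> D" for x c
    proof -
      have "(\<Sum>i\<in>UNIV. of_int (poly (fst c i) n) * x i) = a c * x j"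
        using D(2) that by (subst sum.remove[of _ j]) (auto simp: a_def)
      then show ?thesis by (simp add: satisfies_def b_def)
    qed
    have b: "\<bar>b c\<bar> \<le> of_int n ^ k" if "c \<in> D" for c
    proof -
      have "\<bar>poly (snd c) n\<bar> \<le> n ^ kk c" using elim that by blast
      also have "\<dots> \<le> n ^ k" using D(1) that elim by (intro power_increasing) (auto simp: k_def)
      finally have "real_of_int \<bar>poly (snd c) n\<bar> \<le> of_int (n ^ k)" by linarith
      then show ?thesis by (simp add: b_def)
    qed
    have a1: "\<bar>a c\<bar> \<ge> 1" if "a c \<noteq> 0" for c
    proof -
      have "\<bar>poly (fst c j) n\<bar> \<ge> 1" using that by (simp add: a_def)
      then show ?thesis unfolding a_def by linarith
    qed
    obtain R where R: "\<And>x. \<forall>c\<in>C. satisfies n x c \<Longrightarrow> \<bar>x j\<bar> \<le> R"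
      using elim(3) unfolding bounded_iff by auto
    have ex: "\<bar>x j\<bar> \<le> R" if "\<forall>c\<in>D. satisfies n x c" for x
    proof -
      from that elim(2) obtain y where "\<forall>i. i \<notin> UNIV - {j} \<longrightarrow> y i = x i" "\<forall>c\<in>C. satisfies n y c"
        by blast
      then have "y j = x j" "\<forall>c\<in>C. satisfies n y c" by simp_all
      then show ?thesis using R by metis
    qed
    show ?case
    proof (intro allI impI)
      fix x assume "\<forall>c\<in>C. satisfies n x c"
      then have x: "\<forall>c\<in>D. satisfies n x c" using elim(2) by blast
      have "\<exists>c\<in>D. a c > 0"
      proof (rule ccontr)
        assume "\<not> ?thesis"
        then have neg: "a c \<le> 0" if "c \<in> D" for c using that by force
        \<comment> \<open>With no positive coefficient, \<open>x j\<close> may be lowered freely;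
          this shift is large enough to leave the interval of radius \<open>R\<close>.\<close>
        define t where "t = \<bar>x j\<bar> + \<bar>R\<bar> + 1"
        have "satisfies n (x(j := x j - t)) c" if c: "c \<in> D" for c
        proof -
          have "a c * t \<le> 0" using neg[OF c] by (intro mult_nonpos_nonneg) (auto simp: t_def)
          moreover have "b c \<le> a c * x j" using x c sat by blast
          ultimately show ?thesis unfolding sat[OF c] by (simp add: algebra_simps)
        qed
        then have "\<bar>x j - t\<bar> \<le> R" using ex[of "x(j := x j - t)"] by simp
        then show False unfolding t_def by linarith
      qed
      then obtain c where c: "c \<in> D" "a c > 0" by blast
      have "\<exists>c\<in>D. a c < 0"
      proof (rule ccontr)
        assume "\<not> ?thesis"
        then have pos: "a c \<ge> 0" if "c \<in> D" for c using that by force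
        define t where "t = \<bar>x j\<bar> + \<bar>R\<bar> + 1"
        have "satisfies n (x(j := x j + t)) c" if c: "c \<in> D" for c
        proof -
          have "a c * t \<ge> 0" using pos[OF c] by (intro mult_nonneg_nonneg) (auto simp: t_def)
          moreover have "b c \<le> a c * x j" using x c sat by blast
          ultimately show ?thesis unfolding sat[OF c] by (simp add: algebra_simps)
        qed
        then have "\<bar>x j + t\<bar> \<le> R" using ex[of "x(j := x j + t)"] by simp
        then show False unfolding t_def by linarith
      qed
      then obtain d where d: "d \<in> D" "a d < 0" by blast
      have K: "real_of_int n ^ k \<ge> 0" using elim by simp
      have "x j \<ge> - (of_int n ^ k)"
      proof (rule ccontr)
        assume "\<not> ?thesis"
        then have lt: "x j < - (of_int n ^ k)" by simp
        have "a c * x j \<le> 1 * x j" using a1[of c] c lt K by (intro mult_right_mono_neg) auto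
        moreover have "b c \<le> a c * x j" using x c sat by blast
        ultimately show False using b[OF c(1)] lt by linarith
      qed
      moreover have "x j \<le> of_int n ^ k"
      proof (rule ccontr)
        assume "\<not> ?thesis"
        then have gt: "x j > of_int n ^ k" by simp
        have "a d * x j \<le> (-1) * x j" using a1[of d] d gt K by (intro mult_right_mono) auto
        moreover have "b d \<le> a d * x j" using x d sat by blast
        ultimately show False using b[OF d(1)] gt by linarith
      qed
      ultimately show "\<bar>x j\<bar> \<le> of_int n ^ k" by simp
    qed
  qed
  then show ?thesis by blast
qed

section \<open>Lattice points\<close>

lemma mem_param_polyhedron_iff:
  "x \<in> param_polyhedron V c n \<longleftrightarrow> (\<forall>q\<in>range (\<lambda>i. (\<lambda>j. V $ i $ j, c $ i)). satisfies n (($) x) q)"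
  by (simp add: param_polyhedron_def less_eq_vec_def matrix_vector_mult_def eval_mat_def eval_vec_def satisfies_def)

lemma eventually_param_polyhedron_bound:
  fixes V :: "int poly ^ 'd ^ 'r" and c :: "int poly ^ 'r"
  assumes "eventually (\<lambda>n. bounded (param_polyhedron V c n)) at_top"
  shows "\<exists>k. eventually (\<lambda>n. \<forall>x\<in>param_polyhedron V c n. \<forall>j. \<bar>x $ j\<bar> \<le> of_int n ^ k) at_top"
proof -
  define C where "C = range (\<lambda>i. (\<lambda>j. V $ i $ j, c $ i))"
  have mem: "x \<in> param_polyhedron V c n \<longleftrightarrow> (\<forall>q\<in>C. satisfies n (($) x) q)" for x n
    unfolding C_def by (rule mem_param_polyhedron_iff)
  have "\<forall>j. \<exists>k. eventually (\<lambda>n. \<forall>x. (\<forall>q\<in>C. satisfies n x q) \<longrightarrow> \<bar>x j\<bar> \<le> of_int n ^ k) at_top"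
  proof (intro allI eventually_coordinate_bound)
    fix j
    show "eventually (\<lambda>n. bounded ((\<lambda>x. x j) ` {x. \<forall>q\<in>C. satisfies n x q})) at_top"
      using assms
    proof eventually_elim
      case (elim n)
      then obtain R where R: "\<And>x. x \<in> param_polyhedron V c n \<Longrightarrow> norm x \<le> R"
        unfolding bounded_iff by blast
      have "\<bar>x j\<bar> \<le> R" if "\<forall>q\<in>C. satisfies n x q" for x
      proof -
        have "($) (vec_lambda x) = x" by (simp add: fun_eq_iff)
        then have "vec_lambda x \<in> param_polyhedron V c n" using that by (simp add: mem)
        from R[OF this] component_le_norm_cart[of "vec_lambda x" j] show ?thesis by simp
      qed
      then show ?case unfolding bounded_iff by auto
    qed
  qed (simp add: C_def)
  from choice[OF this] obtain kk where
    kk: "\<And>j. eventually (\<lambda>n. \<forall>x. (\<forall>q\<in>C. satisfies n x q) \<longrightarrow> \<bar>x j\<bar> \<le> of_int n ^ kk j) at_top"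
    by blast
  define k where "k = Max (range kk)"
  have "eventually (\<lambda>n. \<forall>j. \<forall>x. (\<forall>q\<in>C. satisfies n x q) \<longrightarrow> \<bar>x j\<bar> \<le> of_int n ^ kk j) at_top"
    using kk by (intro eventually_all_finite)
  then have "eventually (\<lambda>n. \<forall>x\<in>param_polyhedron V c n. \<forall>j. \<bar>x $ j\<bar> \<le> of_int n ^ k) at_top"
    using eventually_ge_at_top[of 1]
  proof eventually_elim
    case (elim n)
    have "real_of_int n ^ kk j \<le> of_int n ^ k" for j
      using elim by (intro power_increasing) (auto simp: k_def)
    then show ?case using elim mem order_trans by blast
  qed
  then show ?thesis by blast
qed

section \<open>Expansions in base \<open>n\<close>\<close>

lemma ex_base_digits:
  fixes n X :: int
  assumes "n > 0" "0 \<le> X" "X < n ^ K"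
  shows "\<exists>d. (\<forall>e<K. d e \<in> {0..<n}) \<and> X = (\<Sum>e<K. d e * n ^ e)"
  using assms(2,3)
proof (induction K arbitrary: X)
  case (Suc K)
  have "X div n < n ^ K"
  proof (rule ccontr)
    assume "\<not> ?thesis"
    then have "n * n ^ K \<le> n * (X div n)" using \<open>n > 0\<close> by (intro mult_left_mono) auto
    also have "\<dots> \<le> X" using \<open>n > 0\<close> mult_div_mod_eq[of n X] pos_mod_sign[of n X] by linarith
    finally show False using Suc.prems by simp
  qed
  then obtain d where d: "\<forall>e<K. d e \<in> {0..<n}" "X div n = (\<Sum>e<K. d e * n ^ e)"
    using Suc.IH[of "X div n"] Suc.prems \<open>n > 0\<close> by (auto simp: pos_imp_zdiv_nonneg_iff)
  have "X = X mod n + n * (\<Sum>e<K. d e * n ^ e)"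
    unfolding d(2)[symmetric] by simp
  then have "X = (\<Sum>e<Suc K. case_nat (X mod n) d e * n ^ e)"
    by (simp add: sum.lessThan_Suc_shift sum_distrib_left algebra_simps del: sum.lessThan_Suc)
  then show ?case using d(1) \<open>n > 0\<close>
    by (intro exI[of _ "case_nat (X mod n) d"]) (auto split: nat.split)
qed simp

lemma base_digits_unique:
  fixes n :: int
  assumes "\<forall>e<K. d e \<in> {0..<n}" "\<forall>e<K. d' e \<in> {0..<n}"
    "(\<Sum>e<K. d e * n ^ e) = (\<Sum>e<K. d' e * n ^ e)" "e < K"
  shows "d e = d' e"
  using assms
proof (induction K arbitrary: d d' e)
  case (Suc K)
  have shift: "(\<Sum>e<Suc K. f e * n ^ e) = f 0 + n * (\<Sum>e<K. f (Suc e) * n ^ e)" for f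
    by (simp add: sum.lessThan_Suc_shift sum_distrib_left algebra_simps del: sum.lessThan_Suc)
  have eq: "d 0 + n * (\<Sum>e<K. d (Suc e) * n ^ e) = d' 0 + n * (\<Sum>e<K. d' (Suc e) * n ^ e)"
    using Suc.prems(3) unfolding shift .
  have r: "d 0 \<in> {0..<n}" "d' 0 \<in> {0..<n}" using Suc.prems by auto
  have "d 0 = (d 0 + n * (\<Sum>e<K. d (Suc e) * n ^ e)) mod n" using r by simp
  also have "\<dots> = d' 0" unfolding eq using r by simp
  finally have d0: "d 0 = d' 0" .
  with eq r have rest: "(\<Sum>e<K. d (Suc e) * n ^ e) = (\<Sum>e<K. d' (Suc e) * n ^ e)" by simp
  show ?case
  proof (cases e)
    case (Suc e')
    then have "d (Suc e') = d' (Suc e')"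
      using Suc.prems(1,2,4) by (intro Suc.IH[of "\<lambda>e. d (Suc e)" "\<lambda>e. d' (Suc e)"] rest) simp_all
    then show ?thesis using Suc by simp
  qed (use d0 in simp)
qed simp

section \<open>Counting lattice points by their digits\<close>

theorem theorem2p1:
  fixes V :: "int poly ^ 'd ^ 'r" and c :: "int poly ^ 'r"
  assumes "eventually (\<lambda>n. rational_polytope (param_polyhedron V c n)) at_top"
  shows "(\<lambda>n. int (card (param_polyhedron V c n \<inter> integer_points))) \<in> QP_eventually"
proof -
  have "eventually (\<lambda>n. bounded (param_polyhedron V c n)) at_top"
    using assms by eventually_elim (simp add: rational_polytope_def polytope_imp_bounded)
  then obtain k where
    k: "eventually (\<lambda>n. \<forall>x\<in>param_polyhedron V c n. \<forall>j. \<bar>x $ j\<bar> \<le> of_int n ^ k) at_top"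
    using eventually_param_polyhedron_bound by blast
  \<comment> \<open>A shifted coordinate lies between 0 and \<open>2 * n ^ k\<close>, which is below
    \<open>n ^ Suc k\<close> once \<open>n \<ge> 3\<close>, so \<open>Suc k\<close> digits
    suffice.\<close>
  define K where "K = Suc k"
  define L where "L = CARD('d) * K"
  \<comment> \<open>Numbers the digits of all coordinates from 1 on; slot 0 is reserved for
    \<open>n\<close>.\<close>
  obtain h where h: "bij_betw h ((UNIV :: 'd set) \<times> {..<K}) {1..L}"
    using finite_same_card_bij[of "(UNIV :: 'd set) \<times> {..<K}" "{1..L}"]
    by (auto simp: L_def card_cartesian_product)
  have h_mem: "h (j, e) \<in> {1..L}" if "e < K" for j e
    using bij_betw_apply[OF h] that by auto
  txt \<open>The shift by \<open>n ^ k\<close> makes all coordinates of lattice points of the polytope nonnegative.\<close>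
  define coord where "coord = (\<lambda>(x :: nat \<Rightarrow> int) j. (\<Sum>e<K. x (h (j, e)) * x 0 ^ e) - x 0 ^ k)"
  define form where "form = (\<lambda>i x. (\<Sum>j\<in>UNIV. poly (V $ i $ j) (x 0) * coord x j) - poly (c $ i) (x 0))"
  have power: "(\<lambda>x. a * x 0 ^ e * t x) \<in> digit_forms (Suc L)" if "t \<in> lin_terms (Suc L)" for a e t
    using digit_poly_mult[OF digit_term[OF that], of "monom a e"] by (simp add: poly_monom mult_ac)
  have "(\<lambda>x. coord x j) \<in> digit_forms (Suc L)" for j
  proof -
    have "(\<lambda>x. (\<Sum>e<K. 1 * x 0 ^ e * x (h (j, e))) + (-1) * x 0 ^ k * 1) \<in> digit_forms (Suc L)"
      using h_mem[of _ j] by (intro digit_add digit_sum power lin_var lin_const) (auto simp: less_Suc_eq_le)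
    then show ?thesis by (simp add: coord_def mult.commute)
  qed
  then have "(\<lambda>x. (\<Sum>j\<in>UNIV. poly (V $ i $ j) (x 0) * coord x j) + poly (- (c $ i)) (x 0) * 1) \<in> digit_forms (Suc L)" for i
    by (intro digit_add digit_sum digit_poly_mult digit_term[OF lin_const])
  then have "form i \<in> digit_forms (Suc L)" for i
    by (simp add: form_def)
  then have "\<forall>i. \<exists>f. f \<in> pw_qpolys (Suc L) \<and> (\<forall>x\<in>digit_box (Suc L). f x = of_bool (form i x \<ge> 0))"
    using pw_digit_form_ge_0[of "form _" "Suc L" 0] by fastforce
  from choice[OF this] obtain f where f: "\<And>i. f i \<in> pw_qpolys (Suc L)"
    "\<And>i x. x \<in> digit_box (Suc L) \<Longrightarrow> f i x = of_bool (form i x \<ge> 0)"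
    by blast
  \<comment> \<open>The product of the row indicators tests whether the digits describe a point of
    the polytope, so for large \<open>n\<close> this sum is the number of lattice points.\<close>
  define G where "G = (\<lambda>x :: nat \<Rightarrow> int. \<Sum>y\<in>{1..L} \<rightarrow>\<^sub>E {0..<x 0}. \<Prod>i\<in>UNIV. f i (y(0 := x 0)))"
  have "G \<in> pw_qpolys 1"
    unfolding G_def by (intro pw_sum_box pw_prod f)
  moreover have "eventually (\<lambda>n. rat_of_int (int (card (param_polyhedron V c n \<inter> integer_points))) = G (\<lambda>_. n)) at_top"
    using k eventually_ge_at_top[of 3]
  proof eventually_elim
    case (elim n)
    define B where "B = {1..L} \<rightarrow>\<^sub>E {0..<n}"
    define S where "S = {y\<in>B. \<forall>i. form i (y(0 := n)) \<ge> 0}"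
    define \<phi> :: "(nat \<Rightarrow> int) \<Rightarrow> real ^ 'd" where "\<phi> = (\<lambda>y. \<chi> j. of_int (coord (y(0 := n)) j))"
    have fin: "finite B" unfolding B_def by (intro finite_PiE) auto
    have B_mem: "y (h (j, e)) \<in> {0..<n}" if "y \<in> B" "e < K" for y j e
      using that h_mem[of e j] unfolding B_def by (auto simp: PiE_iff)
    have coord: "coord (y(0 := n)) j = (\<Sum>e<K. y (h (j, e)) * n ^ e) - n ^ k" for y j
    proof -
      have "h (j, e) \<noteq> 0" if "e < K" for e using h_mem[OF that, of j] by simp
      then have "(\<Sum>e<K. (y(0 := n)) (h (j, e)) * n ^ e) = (\<Sum>e<K. y (h (j, e)) * n ^ e)"
        by (intro sum.cong) (simp_all del: neq0_conv)
      then show ?thesis by (simp only: coord_def fun_upd_same)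
    qed
    have \<phi>_mem: "\<phi> y \<in> param_polyhedron V c n \<longleftrightarrow> (\<forall>i. form i (y(0 := n)) \<ge> 0)" for y
    proof -
      have "(\<Sum>j\<in>UNIV. real_of_int (poly (V $ i $ j) n) * of_int (coord (y(0 := n)) j)) \<ge> of_int (poly (c $ i) n)
        \<longleftrightarrow> form i (y(0 := n)) \<ge> 0" for i
      proof -
        have "real_of_int (form i (y(0 := n))) = (\<Sum>j\<in>UNIV. real_of_int (poly (V $ i $ j) n) * of_int (coord (y(0 := n)) j)) - of_int (poly (c $ i) n)"
          by (simp add: form_def)
        moreover have "form i (y(0 := n)) \<ge> 0 \<longleftrightarrow> real_of_int (form i (y(0 := n))) \<ge> 0"
          by (simp only: of_int_0_le_iff)
        ultimately show ?thesis by linarith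
      qed
      then show ?thesis by (simp add: mem_param_polyhedron_iff satisfies_def \<phi>_def)
    qed
    \<comment> \<open>Decoding is injective by uniqueness of digits, and surjective because the
      growth bound gives every lattice point an expansion with \<open>K\<close> digits per
      coordinate.\<close>
    have "bij_betw \<phi> S (param_polyhedron V c n \<inter> integer_points)"
    proof (rule bij_betw_imageI)
      show "inj_on \<phi> S"
      proof
        fix y y' assume y: "y \<in> S" "y' \<in> S" "\<phi> y = \<phi> y'"
        then have B: "y \<in> B" "y' \<in> B" by (auto simp: S_def)
        have "y (h (j, e)) = y' (h (j, e))" if "e < K" for j e
        proof (rule base_digits_unique[of K "\<lambda>e. y (h (j, e))" n "\<lambda>e. y' (h (j, e))" e])
          have "coord (y(0 := n)) j = coord (y'(0 := n)) j"
            using y(3) by (simp add: \<phi>_def vec_eq_iff)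
          then show "(\<Sum>e<K. y (h (j, e)) * n ^ e) = (\<Sum>e<K. y' (h (j, e)) * n ^ e)"
            unfolding coord by simp
        qed (use B B_mem that in auto)
        then have "y m = y' m" if "m \<in> h ` (UNIV \<times> {..<K})" for m
          using that by auto
        then have "y m = y' m" if "m \<in> {1..L}" for m
          using that h by (simp add: bij_betw_def)
        then show "y = y'" using B unfolding B_def by (auto intro: PiE_ext)
      qed
      show "\<phi> ` S = param_polyhedron V c n \<inter> integer_points"
      proof
        show "\<phi> ` S \<subseteq> param_polyhedron V c n \<inter> integer_points"
          using \<phi>_mem by (auto simp: S_def integer_points_def) (simp add: \<phi>_def)
        show "param_polyhedron V c n \<inter> integer_points \<subseteq> \<phi> ` S"
        proof
          fix x assume x: "x \<in> param_polyhedron V c n \<inter> integer_points"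
          then have "\<forall>j. \<exists>X. x $ j = real_of_int X" by (auto simp: integer_points_def Ints_def)
          from choice[OF this] obtain X where X: "\<And>j. x $ j = real_of_int (X j)" by blast
          have "\<exists>d. (\<forall>e<K. d e \<in> {0..<n}) \<and> X j + n ^ k = (\<Sum>e<K. d e * n ^ e)" for j
          proof (rule ex_base_digits)
            have "\<bar>x $ j\<bar> \<le> of_int n ^ k" using elim x by blast
            then have "real_of_int \<bar>X j\<bar> \<le> of_int (n ^ k)" using X by simp
            then have Xb: "\<bar>X j\<bar> \<le> n ^ k" by (simp only: of_int_le_iff)
            then show "0 \<le> X j + n ^ k" by simp
            have "3 * n ^ k \<le> n * n ^ k" using elim by (intro mult_right_mono) auto
            moreover have "n ^ k > 0" using elim by simp
            ultimately show "X j + n ^ k < n ^ K" using Xb unfolding K_def power_Suc by linarith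
          qed (use elim in simp)
          then have "\<forall>j. \<exists>d. (\<forall>e<K. d e \<in> {0..<n}) \<and> X j + n ^ k = (\<Sum>e<K. d e * n ^ e)" by blast
          from choice[OF this] obtain d where
            d: "\<And>j e. e < K \<Longrightarrow> d j e \<in> {0..<n}" "\<And>j. X j + n ^ k = (\<Sum>e<K. d j e * n ^ e)" by blast
          \<comment> \<open>Places digit \<open>e\<close> of coordinate \<open>j\<close> into slot
            \<open>h (j, e)\<close>; the restriction makes \<open>y\<close> extensional, as
            membership in \<open>B\<close> demands.\<close>
          define y where "y = restrict (\<lambda>m. case inv_into (UNIV \<times> {..<K}) h m of (j, e) \<Rightarrow> d j e) {1..L}"
          have y: "y (h (j, e)) = d j e" if "e < K" for j e
            using that h_mem[OF that, of j] bij_betw_inv_into_left[OF h, of "(j, e)"] by (simp add: y_def)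
          have "y \<in> B"
            unfolding B_def
          proof (rule PiE_I)
            fix m assume "m \<in> {1..L}"
            then have "m \<in> h ` (UNIV \<times> {..<K})" using h by (simp add: bij_betw_def)
            then obtain j e where "e < K" "m = h (j, e)" by auto
            then show "y m \<in> {0..<n}" using y d by simp
          qed (auto simp: y_def)
          have "\<phi> y = x"
          proof -
            have "coord (y(0 := n)) j = X j" for j
              using d(2)[of j] y unfolding coord by simp
            then show ?thesis by (simp add: \<phi>_def vec_eq_iff X)
          qed
          with \<phi>_mem[of y] x \<open>y \<in> B\<close> show "x \<in> \<phi> ` S" by (auto simp: S_def)
        qed
      qed
    qed
    then have "card (param_polyhedron V c n \<inter> integer_points) = card S"
      by (simp add: bij_betw_same_card)
    also have "rat_of_nat (card S) = (\<Sum>y\<in>B. of_bool (\<forall>i. form i (y(0 := n)) \<ge> 0))"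
      unfolding S_def using fin by (simp add: Int_def)
    also have "\<dots> = (\<Sum>y\<in>B. \<Prod>i\<in>UNIV. f i (y(0 := n)))"
    proof (rule sum.cong)
      fix y assume "y \<in> B"
      then have box: "y(0 := n) \<in> digit_box (Suc L)"
        using elim by (auto simp: B_def digit_box_def PiE_iff less_Suc_eq_le Suc_le_eq less_imp_le)
      have "(\<Prod>i\<in>UNIV. f i (y(0 := n))) = (\<Prod>i\<in>UNIV. of_bool (form i (y(0 := n)) \<ge> 0))"
        using f(2)[OF box] by simp
      also have "\<dots> = of_bool (\<forall>i. form i (y(0 := n)) \<ge> 0)"
        by (cases "\<forall>i. form i (y(0 := n)) \<ge> 0") (auto intro!: prod_zero)
      finally show "of_bool (\<forall>i. form i (y(0 := n)) \<ge> 0) = (\<Prod>i\<in>UNIV. f i (y(0 := n)))" by simp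
    qed simp
    finally show ?case by (simp add: G_def B_def)
  qed
  ultimately show ?thesis by (rule QP_eventually_if_pw_qpoly)
qed

end
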